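(* Let $k\ge1$, let $\nabla\mathcal F_k$ be the MICE gradient estimator for the minimization of $F(\boldsymbol\xi)=\mathbb E[f(\boldsymbol\xi,\boldsymbol\theta)]$ (see context), and let $\mathcal L_k^\cap=\mathcal L_k\cap\mathcal L_{k-1}$. Then the statistical error of the estimator is $$\mathbb E\Big\|\nabla\mathcal F_k-\mathbb E\big[\nabla\mathcal F_k\,\big|\,\{\boldsymbol\xi_{\ell'}\}_{\ell'\in\mathcal L_k}\big]\Big\|^2=\mathbb E\left[\sum_{\ell\in\mathcal L_k^\cap}\frac{(M_{\ell,k}-M_{\ell,k-1})\,V_{\ell,k}}{M_{\ell,k}^2}\right]+\mathbb E\left[\frac{V_{k,k}}{M_{k,k}}\right].$$
   Context: $\boldsymbol\theta\sim\pi$ is a random vector whose law $\pi$ does not depend on $\boldsymbol\xi\in\mathbb R^d$; $\nabla F(\boldsymbol\xi)=\mathbb E[\nabla_{\boldsymbol\xi}f(\boldsymbol\xi,\boldsymbol\theta)]$; all gradients involved are square integrable. Index sets: $\mathcal L_0=\{0\}$ and $k\in\mathcal L_k\subset\mathcal L_{k-1}\cup\{k\}\subset\{0,\dots,k\}$. For $\ell\in\mathcal L_k$, $\ell>\min\mathcal L_k$, let $p_k(\ell)=\max\{\ell'\in\mathcal L_k:\ell'<\ell\}$. Set $\Delta_{\ell,k}(\boldsymbol\theta)=\nabla_{\boldsymbol\xi} f(\boldsymbol\xi_\ell,\boldsymbol\theta)-\nabla_{\boldsymbol\xi} f(\boldsymbol\xi_{p_k(\ell)},\boldsymbol\theta)$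 if $\ell>\min\mathcal L_k$, and $\Delta_{\ell,k}(\boldsymbol\theta)=\nabla_{\boldsymbol\xi} f(\boldsymbol\xi_\ell,\boldsymbol\theta)$ if $\ell=\min\mathcal L_k$. Given index sets $\mathcal L_k$ and positive integers $M_{\ell,k}$ (with $M_{\ell,k}\ge M_{\ell,k-1}$ for $\ell\in\mathcal L_k^\cap$), the MICE estimator is $$\nabla\mathcal F_k=\sum_{\ell\in\mathcal L_k}\hat{\boldsymbol\mu}_{\ell,k},\qquad\hat{\boldsymbol\mu}_{\ell,k}=\frac1{M_{\ell,k}}\sum_{\alpha\in\mathcal I_{\ell,k}}\Delta_{\ell,k}(\boldsymbol\theta_\alpha),$$ where $\mathcal I_{\ell,k}$ indexes the first $M_{\ell,k}$ elements of a sequence of i.i.d. samples from $\pi$ attached to level $\ell$; the sequences of different levels are independent of each other and of $\boldsymbol\xi_0$. Samples are cumulative ($\mathcal I_{\ell,k-1}\subset\mathcal I_{\ell,k}$, the samples in $\mathcal I_{\ell,k}\setminus\mathcal I_{\ell,k-1}$ being drawn at iteration $k$). The iterate $\boldsymbol\xi_{k+1}$ is a deterministic function of $\boldsymbol\xi_0$ and the samples drawn at iterations $0,\dots,k$. Levels common to $\mathcal L_k$ and $\mathcal L_{k-1}$ keep their differences, $\Delta_{\ell,k}=\Delta_{\ell,k-1}$ for $\ell\in\mathcal L_k^\cap$, so that $$\nabla\mathcal F_k=\sum_{\ell\in\mathcal L_k^\cap}\frac{M_{\ell,k-1}}{M_{\ell,k}}\hat{\boldsymbol\mu}_{\ell,k-1}+\sum_{\ell\in\mathcal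 L_k^\cap}\frac1{M_{\ell,k}}\sum_{\alpha\in\mathcal I_{\ell,k}\setminus\mathcal I_{\ell,k-1}}\Delta_{\ell,k}(\boldsymbol\theta_\alpha)+\hat{\boldsymbol\mu}_{k,k}.$$ $V_{\ell,k}$ is the sum over the $d$ components of the variances of $\Delta_{\ell,k}(\boldsymbol\theta)$ given the iterates, with $\boldsymbol\theta\sim\pi$ independent of the iterates. The conditional expectation $\mathbb E[\,\cdot\mid\{\boldsymbol\xi_{\ell'}\}_{\ell'\in\mathcal L_k}]$ is understood as conditioning on the whole history before iteration $k$'s sampling: the iterates and all quantities computed from samples drawn at iterations $<k$ are deterministic under it. *)

theory Defs
  imports "HOL-Probability.Probability"
begin

(* The library has conditional expectations of real random variables only;
   for random vectors it is taken componentwise. *)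
definition vec_cond_exp ::
    "'w measure \<Rightarrow> 'w measure \<Rightarrow> ('w \<Rightarrow> real ^ 'd) \<Rightarrow> 'w \<Rightarrow> real ^ 'd" where
  "vec_cond_exp M H X = (\<lambda>w. \<chi> i. real_cond_exp M H (\<lambda>w. X w $ i) w)"

definition objective :: "'t measure \<Rightarrow> (real ^ 'd \<Rightarrow> 't \<Rightarrow> real) \<Rightarrow> real ^ 'd \<Rightarrow> real" where
  "objective P f x = (\<integral>t. f x t \<partial>P)"

definition pred_level :: "(nat \<Rightarrow> nat set) \<Rightarrow> nat \<Rightarrow> nat \<Rightarrow> nat" where
  "pred_level L k l = Max {l' \<in> L k. l' < l}"

(* In what follows w is the sample point, g x t is the gradient of f(., t) at x, xi l is the
   l-th iterate, L k is the index set of iteration k, m l k is the sample size M_{l,k}, and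
   theta (l, a) is the a-th sample of level l, counted from 0, so that I_{l,k} = {..<m l k}. *)

definition delta ::
    "(real ^ 'd \<Rightarrow> 't \<Rightarrow> real ^ 'd) \<Rightarrow> (nat \<Rightarrow> 'w \<Rightarrow> real ^ 'd) \<Rightarrow> (nat \<Rightarrow> nat set)
      \<Rightarrow> nat \<Rightarrow> nat \<Rightarrow> 'w \<Rightarrow> 't \<Rightarrow> real ^ 'd" where
  "delta g xi L l k w t =
     (if Min (L k) < l then g (xi l w) t - g (xi (pred_level L k l) w) t
      else g (xi l w) t)"

definition mu_hat ::
    "(real ^ 'd \<Rightarrow> 't \<Rightarrow> real ^ 'd) \<Rightarrow> (nat \<Rightarrow> 'w \<Rightarrow> real ^ 'd) \<Rightarrow> (nat \<Rightarrow> nat set)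
      \<Rightarrow> (nat \<Rightarrow> nat \<Rightarrow> nat) \<Rightarrow> (nat \<times> nat \<Rightarrow> 'w \<Rightarrow> 't) \<Rightarrow> nat \<Rightarrow> nat \<Rightarrow> 'w \<Rightarrow> real ^ 'd" where
  "mu_hat g xi L m theta l k w =
     (1 / real (m l k)) *\<^sub>R (\<Sum>a<m l k. delta g xi L l k w (theta (l, a) w))"

definition mice_estimator ::
    "(real ^ 'd \<Rightarrow> 't \<Rightarrow> real ^ 'd) \<Rightarrow> (nat \<Rightarrow> 'w \<Rightarrow> real ^ 'd) \<Rightarrow> (nat \<Rightarrow> nat set)
      \<Rightarrow> (nat \<Rightarrow> nat \<Rightarrow> nat) \<Rightarrow> (nat \<times> nat \<Rightarrow> 'w \<Rightarrow> 't) \<Rightarrow> nat \<Rightarrow> 'w \<Rightarrow> real ^ 'd" where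
  "mice_estimator g xi L m theta k w = (\<Sum>l\<in>L k. mu_hat g xi L m theta l k w)"

(* Variance over theta ~ P with the iterates held fixed at their values at w;
   the result is a random variable in w. *)
definition level_variance ::
    "'t measure \<Rightarrow> (real ^ 'd \<Rightarrow> 't \<Rightarrow> real ^ 'd) \<Rightarrow> (nat \<Rightarrow> 'w \<Rightarrow> real ^ 'd) \<Rightarrow> (nat \<Rightarrow> nat set)
      \<Rightarrow> nat \<Rightarrow> nat \<Rightarrow> 'w \<Rightarrow> real" where
  "level_variance P g xi L l k w =
     (\<Sum>i\<in>UNIV. prob_space.variance P (\<lambda>t. delta g xi L l k w t $ i))"

(* Indices of the samples drawn at iterations 0, ..., k - 1. *)
definition drawn_before :: "(nat \<Rightarrow> nat set) \<Rightarrow> (nat \<Rightarrow> nat \<Rightarrow> nat) \<Rightarrow> nat \<Rightarrow> (nat \<times> nat) set" where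
  "drawn_before L m k = {(l, a). \<exists>j<k. l \<in> L j \<and> a < m l j}"

definition history ::
    "(nat \<Rightarrow> 'w \<Rightarrow> real ^ 'd) \<Rightarrow> (nat \<Rightarrow> nat set) \<Rightarrow> (nat \<Rightarrow> nat \<Rightarrow> nat)
      \<Rightarrow> (nat \<times> nat \<Rightarrow> 'w \<Rightarrow> 't) \<Rightarrow> nat \<Rightarrow> 'w \<Rightarrow> (real ^ 'd) \<times> (nat \<times> nat \<Rightarrow> 't)" where
  "history xi L m theta k w = (xi 0 w, \<lambda>p\<in>drawn_before L m k. theta p w)"

definition history_space ::
    "'t measure \<Rightarrow> (nat \<Rightarrow> nat set) \<Rightarrow> (nat \<Rightarrow> nat \<Rightarrow> nat) \<Rightarrow> nat
      \<Rightarrow> ((real ^ 'd) \<times> (nat \<times> nat \<Rightarrow> 't)) measure" where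
  "history_space P L m k = borel \<Otimes>\<^sub>M (\<Pi>\<^sub>M p\<in>drawn_before L m k. P)"

(* The sigma-algebra generated by the history before the sampling of iteration k. *)
definition history_algebra ::
    "'w measure \<Rightarrow> 't measure \<Rightarrow> (nat \<Rightarrow> 'w \<Rightarrow> real ^ 'd) \<Rightarrow> (nat \<Rightarrow> nat set)
      \<Rightarrow> (nat \<Rightarrow> nat \<Rightarrow> nat) \<Rightarrow> (nat \<times> nat \<Rightarrow> 'w \<Rightarrow> 't) \<Rightarrow> nat \<Rightarrow> 'w measure" where
  "history_algebra M P xi L m theta k =
     vimage_algebra (space M) (history xi L m theta k) (history_space P L m k)"

locale mice = prob_space M
  for M :: "'w measure" +
  fixes P :: "'t measure"
    and f :: "real ^ 'd \<Rightarrow> 't \<Rightarrow> real"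
    and g :: "real ^ 'd \<Rightarrow> 't \<Rightarrow> real ^ 'd"
    and xi :: "nat \<Rightarrow> 'w \<Rightarrow> real ^ 'd"
    and L :: "nat \<Rightarrow> nat set"
    and m :: "nat \<Rightarrow> nat \<Rightarrow> nat"
    and theta :: "nat \<times> nat \<Rightarrow> 'w \<Rightarrow> 't"
  assumes prob_P: "prob_space P"
    and f_measurable: "(\<lambda>(x, t). f x t) \<in> borel_measurable (borel \<Otimes>\<^sub>M P)"
    and f_integrable: "integrable P (f x)"
    and f_gradient: "t \<in> space P \<Longrightarrow> GDERIV (\<lambda>x. f x t) x :> g x t"
    and g_integrable: "integrable P (g x)"
    and objective_gradient: "GDERIV (objective P f) x :> (\<integral>t. g x t \<partial>P)"
    and level_0: "L 0 = {0}"
    and level_mem: "k \<ge> 1 \<Longrightarrow> k \<in> L k"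
    and level_subset: "k \<ge> 1 \<Longrightarrow> L k \<subseteq> L (k - 1) \<union> {k}"
    and size_pos: "l \<in> L k \<Longrightarrow> m l k > 0"
    and size_mono: "k \<ge> 1 \<Longrightarrow> l \<in> L k \<inter> L (k - 1) \<Longrightarrow> m l (k - 1) \<le> m l k"
    and samples_distr: "distr M P (theta p) = P"
    and samples_indep: "indep_vars (\<lambda>_. P) theta UNIV"
    and start_measurable: "xi 0 \<in> borel_measurable M"
    (* indep_var does not apply: it needs both variables to have the same value type *)
    and samples_indep_start:
      "indep_set (sets (vimage_algebra (space M) (xi 0) borel))
         (sets (vimage_algebra (space M) (\<lambda>w. \<lambda>p\<in>UNIV. theta p w) (\<Pi>\<^sub>M p\<in>UNIV. P)))"
    and iterates:
      "\<exists>G \<in> borel_measurable (history_space P L m (Suc k)).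
         \<forall>w\<in>space M. xi (Suc k) w = G (history xi L m theta (Suc k) w)"
    (* xi k and an independent draw t ~ P *)
    and square_integrable:
      "integrable (M \<Otimes>\<^sub>M P) (\<lambda>(w, t). (norm (g (xi k w) t))\<^sup>2)"

end

theory Submission
  imports Defs
begin

text \<open>
  Given the history before iteration \<open>k\<close>, the MICE estimator is a known vector plus a weighted sum
  of differences evaluated at samples that have not been drawn yet. A known sample contributes
  nothing to the statistical error, and a fresh sample \<open>p\<close> of level \<open>l\<close> contributes its deviation
  from the conditional mean, with weight \<open>1 / m l k\<close>. The deviations of distinct fresh samples are
  orthogonal, so the mean square error is the sum of their second moments. The second moment of one
  deviation, summed over the components, is the expectation of the level variance. It
  remains to count the fresh samples: \<open>m l k - m l (k - 1)\<close> of them at a level kept from iteration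
  \<open>k - 1\<close>, and all \<open>m k k\<close> of them at the new level \<open>k\<close>.

  All probabilistic content sits in one independence statement, lemma \<open>fresh_draw\<close>: a sample \<open>p\<close>
  is independent of the sigma-algebra generated by the starting point and all other samples. As long
  as \<open>p\<close> has not been drawn before iteration \<open>k\<close>, this sigma-algebra contains the history and makes
  every other deviation measurable. Integrating out the sample \<open>p\<close> while everything else is
  frozen then gives at once the conditional mean of the estimator (\<open>estimator_deviation\<close>),
  the orthogonality (\<open>deviations_orthogonal\<close>) and the second moments
  (\<open>deviation_second_moment\<close>).

  The same device yields integrability of the samples drawn earlier: the difference of level \<open>l\<close>
  involves only iterates up to \<open>l\<close>, and no sample of level \<open>l\<close> is drawn before iteration \<open>l\<close>, so
  every sample of that level is fresh with respect to the iterates it is combined with.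
\<close>

section \<open>Integrating out an independent draw\<close>

text \<open>If \<open>D\<close> is independent of \<open>A\<close>, and \<open>B\<close>, \<open>C\<close> are independent parts of \<open>D\<close>, then \<open>A\<close> can be joined to
  \<open>B\<close>: the intersections \<open>a \<inter> b\<close> form a generator that is stable under intersection, and on it the
  product rule follows by splitting off first \<open>a\<close> and then \<open>b\<close>.\<close>

lemma (in prob_space) indep_set_join:
  assumes AD: "indep_set A D" and BC: "indep_set B C"
    and sub: "B \<subseteq> D" "C \<subseteq> D"
    and stable: "Int_stable A" "Int_stable B" "Int_stable C" "Int_stable D"
    and space: "space M \<in> A" "space M \<in> B"
  shows "indep_set (sigma_sets (space M) (A \<union> B)) (sigma_sets (space M) C)"
proof -
  define G where "G = {a \<inter> b | a b. a \<in> A \<and> b \<in> B}"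
  have events: "A \<subseteq> events" "D \<subseteq> events" "B \<subseteq> events" "C \<subseteq> events"
    using indep_setD_ev1[OF AD] indep_setD_ev2[OF AD] indep_setD_ev1[OF BC] indep_setD_ev2[OF BC]
    by auto
  have "indep_set G C"
  proof (rule indep_setI)
    show "G \<subseteq> events" "C \<subseteq> events"
      using events by (auto simp: G_def)
  next
    fix e c assume "e \<in> G" and c: "c \<in> C"
    then obtain a b where e: "e = a \<inter> b" and a: "a \<in> A" and b: "b \<in> B"
      by (auto simp: G_def)
    have bc: "b \<inter> c \<in> D"
      using stable(4) b c sub by (auto simp: Int_stable_def)
    have "prob (e \<inter> c) = prob (a \<inter> (b \<inter> c))"
      by (simp add: e Int_assoc)
    also have "\<dots> = prob a * (prob b * prob c)"
      using indep_setD[OF AD a bc] indep_setD[OF BC b c] by simp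
    also have "\<dots> = prob (a \<inter> b) * prob c"
      using indep_setD[OF AD a, of b] b sub by auto
    finally show "prob (e \<inter> c) = prob e * prob c"
      by (simp add: e)
  qed
  moreover have "Int_stable G"
  proof (rule Int_stableI)
    fix x y assume "x \<in> G" "y \<in> G"
    then obtain a b a' b' where *: "x = a \<inter> b" "y = a' \<inter> b'" "a \<in> A" "b \<in> B" "a' \<in> A" "b' \<in> B"
      by (auto simp: G_def)
    then have "x \<inter> y = (a \<inter> a') \<inter> (b \<inter> b')" "a \<inter> a' \<in> A" "b \<inter> b' \<in> B"
      using stable by (auto simp: Int_stable_def)
    then show "x \<inter> y \<in> G"
      by (auto simp: G_def)
  qed
  ultimately have *: "indep_set (sigma_sets (space M) G) (sigma_sets (space M) C)"
    using stable(3) by (intro indep_set_sigma_sets)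
  \<comment> \<open>Taking the other factor to be the whole space recovers each family from the intersections.\<close>
  have "A \<union> B \<subseteq> G"
  proof
    fix x assume "x \<in> A \<union> B"
    then have "x \<subseteq> space M"
      using events sets.sets_into_space by blast
    then have "x = x \<inter> space M" "x = space M \<inter> x" by auto
    then show "x \<in> G"
      using \<open>x \<in> A \<union> B\<close> space unfolding G_def by blast
  qed
  then have "sigma_sets (space M) (A \<union> B) \<subseteq> sigma_sets (space M) G"
    by (rule sigma_sets_mono')
  with * show ?thesis
    unfolding indep_sets2_eq by blast
qed

text \<open>A draw from \<open>P\<close> that is independent of the information \<open>F\<close>. Working with a sub-sigma-algebra,
  not with a random variable that generates it, leaves any \<open>F\<close>-measurable quantity free to be used
  alongside the draw.\<close>

locale fresh_draw = prob_space M
  for M :: "'w measure" +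
  fixes F :: "'w measure" and P :: "'t measure" and T :: "'w \<Rightarrow> 't"
  assumes subalg: "subalgebra M F"
    and draw_measurable: "T \<in> measurable M P"
    and draw_distr: "distr M P T = P"
    and draw_indep: "indep_set (sets F) (sets (vimage_algebra (space M) T P))"
begin

sublocale P: prob_space P
  using prob_space_distr[OF draw_measurable] by (simp add: draw_distr)

sublocale MP: pair_sigma_finite M P ..

lemma id_measurable: "(\<lambda>w. w) \<in> measurable M F"
  using subalg by (auto simp: measurable_def subalgebra_def)

lemma id_pair_measurable: "(\<lambda>x. x) \<in> measurable (M \<Otimes>\<^sub>M P) (F \<Otimes>\<^sub>M P)"
proof -
  have "(\<lambda>x. (fst x, snd x)) \<in> measurable (M \<Otimes>\<^sub>M P) (F \<Otimes>\<^sub>M P)"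
    by (intro measurable_Pair measurable_snd measurable_compose[OF measurable_fst id_measurable])
  then show ?thesis by simp
qed

text \<open>The freezing principle: paired with the full sample point, as far as \<open>F\<close> can see it, the draw behaves
  like a second coordinate that is sampled separately. Both sides agree on rectangles by
  independence.\<close>

lemma pair_distr:
  "distr M (F \<Otimes>\<^sub>M P) (\<lambda>w. (w, T w)) = distr (M \<Otimes>\<^sub>M P) (F \<Otimes>\<^sub>M P) (\<lambda>x. x)"
proof -
  let ?N = "distr M F (\<lambda>w. w)"
  note [measurable] = id_measurable draw_measurable
  have pair: "(\<lambda>w. (w, T w)) \<in> measurable M (F \<Otimes>\<^sub>M P)"
    by simp
  interpret N: prob_space ?N
    by (rule prob_space_distr) simp
  have "?N \<Otimes>\<^sub>M P = distr M (F \<Otimes>\<^sub>M P) (\<lambda>w. (w, T w))"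
  proof (rule pair_measure_eqI)
    fix A B assume "A \<in> sets ?N" and B: "B \<in> sets P"
    then have A: "A \<in> sets F" by simp
    then have AM: "A \<in> sets M" "A \<inter> space M = A"
      using subalg sets.sets_into_space[of A M] by (auto simp: subalgebra_def)
    have TB: "T -` B \<inter> space M \<in> sets M"
      using B by simp
    have "emeasure (distr M (F \<Otimes>\<^sub>M P) (\<lambda>w. (w, T w))) (A \<times> B)
        = emeasure M (A \<inter> (T -` B \<inter> space M))"
      using A B pair by (subst emeasure_distr) (auto intro!: arg_cong[where f="emeasure M"])
    also have "\<dots> = ennreal (prob A * prob (T -` B \<inter> space M))"
      using indep_setD[OF draw_indep A in_vimage_algebra[OF B]] by (simp add: emeasure_eq_measure)
    also have "\<dots> = emeasure M A * emeasure (distr M P T) B"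
      using B by (simp add: emeasure_distr emeasure_eq_measure ennreal_mult)
    also have "\<dots> = emeasure ?N A * emeasure P B"
      using A AM by (simp add: draw_distr emeasure_distr)
    finally show "emeasure ?N A * emeasure P B
        = emeasure (distr M (F \<Otimes>\<^sub>M P) (\<lambda>w. (w, T w))) (A \<times> B)" ..
  qed (simp_all add: N.sigma_finite_measure_axioms P.sigma_finite_measure_axioms)
  moreover have "?N \<Otimes>\<^sub>M distr P P (\<lambda>t. t) = distr (M \<Otimes>\<^sub>M P) (F \<Otimes>\<^sub>M P) (\<lambda>(x, y). (x, y))"
    by (rule pair_measure_distr) (simp_all add: P.sigma_finite_measure_axioms distr_id)
  ultimately show ?thesis
    by (simp add: distr_id id_def)
qed

lemma pair_measurable: "(\<lambda>w. (w, T w)) \<in> measurable M (F \<Otimes>\<^sub>M P)"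
  using id_measurable draw_measurable by simp

lemma integrable_draw_iff:
  fixes \<phi> :: "'w \<times> 't \<Rightarrow> real"
  assumes "\<phi> \<in> borel_measurable (F \<Otimes>\<^sub>M P)"
  shows "integrable M (\<lambda>w. \<phi> (w, T w)) \<longleftrightarrow> integrable (M \<Otimes>\<^sub>M P) \<phi>"
  using integrable_distr_eq[OF pair_measurable assms] integrable_distr_eq[OF id_pair_measurable assms]
  by (simp add: pair_distr)

lemma integral_draw:
  fixes \<phi> :: "'w \<times> 't \<Rightarrow> real"
  assumes "\<phi> \<in> borel_measurable (F \<Otimes>\<^sub>M P)"
  shows "(\<integral>w. \<phi> (w, T w) \<partial>M) = (\<integral>x. \<phi> x \<partial>(M \<Otimes>\<^sub>M P))"
  using integral_distr[OF pair_measurable assms] integral_distr[OF id_pair_measurable assms]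
  by (simp add: pair_distr)

text \<open>By the freezing principle the integral is a double one, whose inner integral over the draw
  vanishes; a product that is not integrable has integral \<open>0\<close> by convention.\<close>

lemma centred_draw_orthogonal:
  fixes \<phi> :: "'w \<times> 't \<Rightarrow> real"
  assumes \<phi>: "\<phi> \<in> borel_measurable (F \<Otimes>\<^sub>M P)" and \<psi>: "\<psi> \<in> borel_measurable F"
    and centred: "\<And>w. w \<in> space M \<Longrightarrow> (\<integral>t. \<phi> (w, t) \<partial>P) = 0"
  shows "(\<integral>w. \<psi> w * \<phi> (w, T w) \<partial>M) = 0"
proof -
  let ?h = "\<lambda>x. \<psi> (fst x) * \<phi> x"
  note [measurable] = \<phi> \<psi>
  have "?h \<in> borel_measurable (F \<Otimes>\<^sub>M P)"
    by measurable
  then have "(\<integral>w. ?h (w, T w) \<partial>M) = (\<integral>x. ?h x \<partial>(M \<Otimes>\<^sub>M P))"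
    by (rule integral_draw)
  also have "\<dots> = 0"
  proof (cases "integrable (M \<Otimes>\<^sub>M P) ?h")
    case True
    then have "(\<integral>x. ?h x \<partial>(M \<Otimes>\<^sub>M P)) = (\<integral>w. (\<integral>t. ?h (w, t) \<partial>P) \<partial>M)"
      by (rule MP.integral_fst'[symmetric])
    also have "\<dots> = (\<integral>w. 0 \<partial>M)"
      by (rule Bochner_Integration.integral_cong) (simp_all add: centred)
    finally show ?thesis by simp
  qed (rule not_integrable_integral_eq)
  finally show ?thesis by simp
qed

end

section \<open>Gradients and square-integrable sums\<close>

text \<open>The gradient is a pointwise limit of difference quotients along a fixed sequence of steps, hence
  inherits joint measurability from the function itself.\<close>

lemma gradient_component_limit:
  fixes h :: "real ^ 'd \<Rightarrow> real"
  assumes "GDERIV h x :> D"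
  shows "(\<lambda>n. (h (x + inverse (real (Suc n)) *\<^sub>R axis i 1) - h x) * real (Suc n)) \<longlonglongrightarrow> D $ i"
proof -
  let ?s = "\<lambda>s::real. x + s *\<^sub>R axis i 1"
  have "(?s has_derivative (\<lambda>s. s *\<^sub>R axis i 1)) (at 0)"
    by (auto intro!: derivative_eq_intros)
  moreover have "(h has_derivative (\<lambda>v. v \<bullet> D)) (at (?s 0))"
    using assms by (simp add: gderiv_def)
  ultimately have "((\<lambda>s. h (?s s)) has_derivative (\<lambda>s. (s *\<^sub>R axis i 1) \<bullet> D)) (at 0)"
    by (rule has_derivative_compose)
  then have "((\<lambda>s. h (?s s)) has_real_derivative D $ i) (at 0)"
    by (simp add: has_field_derivative_def inner_axis' mult_commute_abs)
  then have "((\<lambda>s. (h (?s s) - h x) / s) \<longlongrightarrow> D $ i) (at 0)"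
    by (simp add: DERIV_def)
  moreover have "filterlim (\<lambda>n. inverse (real (Suc n))) (at 0) sequentially"
    using LIMSEQ_inverse_real_of_nat by (auto simp: filterlim_at)
  ultimately have "(\<lambda>n. (h (?s (inverse (real (Suc n)))) - h x) / inverse (real (Suc n))) \<longlonglongrightarrow> D $ i"
    by (rule filterlim_compose)
  then show ?thesis
    by (simp add: divide_inverse)
qed


lemma integrable_mult_of_squares:
  fixes a b :: "'a \<Rightarrow> real"
  assumes [measurable]: "a \<in> borel_measurable M" "b \<in> borel_measurable M"
    and int: "integrable M (\<lambda>x. (a x)\<^sup>2)" "integrable M (\<lambda>x. (b x)\<^sup>2)"
  shows "integrable M (\<lambda>x. a x * b x)"
proof (rule Bochner_Integration.integrable_bound)
  show "integrable M (\<lambda>x. (a x)\<^sup>2 + (b x)\<^sup>2)"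
    using int by simp
  have "\<bar>u * v\<bar> \<le> u\<^sup>2 + v\<^sup>2" for u v :: real
    using sum_squares_bound[of "\<bar>u\<bar>" "\<bar>v\<bar>"] abs_ge_zero[of "u * v"]
    unfolding power2_abs abs_mult by linarith
  then show "AE x in M. norm (a x * b x) \<le> norm ((a x)\<^sup>2 + (b x)\<^sup>2)"
    by simp
qed simp

lemma integrable_square_diff:
  fixes a b :: "'a \<Rightarrow> real"
  assumes "a \<in> borel_measurable M" "b \<in> borel_measurable M"
    and "integrable M (\<lambda>x. (a x)\<^sup>2)" "integrable M (\<lambda>x. (b x)\<^sup>2)"
  shows "integrable M (\<lambda>x. (a x - b x)\<^sup>2)"
  using assms integrable_mult_of_squares[OF assms]
  by (simp add: power2_diff mult.assoc)

lemma integral_square_sum_orthogonal: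
  fixes X :: "'i \<Rightarrow> 'a \<Rightarrow> real"
  assumes fin: "finite S"
    and meas: "\<And>p. p \<in> S \<Longrightarrow> X p \<in> borel_measurable M"
    and int: "\<And>p. p \<in> S \<Longrightarrow> integrable M (\<lambda>x. (X p x)\<^sup>2)"
    and orth: "\<And>p q. p \<in> S \<Longrightarrow> q \<in> S \<Longrightarrow> p \<noteq> q \<Longrightarrow> (\<integral>x. X p x * X q x \<partial>M) = 0"
  shows "integrable M (\<lambda>x. (\<Sum>p\<in>S. X p x)\<^sup>2)"
    and "(\<integral>x. (\<Sum>p\<in>S. X p x)\<^sup>2 \<partial>M) = (\<Sum>p\<in>S. \<integral>x. (X p x)\<^sup>2 \<partial>M)"
proof -
  have prod: "integrable M (\<lambda>x. X p x * X q x)" if "p \<in> S" "q \<in> S" for p q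
    using that by (intro integrable_mult_of_squares meas int)
  have expand: "(\<Sum>p\<in>S. X p x)\<^sup>2 = (\<Sum>p\<in>S. \<Sum>q\<in>S. X p x * X q x)" for x
    by (simp add: power2_eq_square sum_product)
  show "integrable M (\<lambda>x. (\<Sum>p\<in>S. X p x)\<^sup>2)"
    unfolding expand using prod by simp
  have "(\<integral>x. (\<Sum>p\<in>S. X p x)\<^sup>2 \<partial>M) = (\<Sum>p\<in>S. \<Sum>q\<in>S. \<integral>x. X p x * X q x \<partial>M)"
    unfolding expand using prod by simp
  also have "\<dots> = (\<Sum>p\<in>S. \<Sum>q\<in>S. if q = p then \<integral>x. X p x * X p x \<partial>M else 0)"
    by (intro sum.cong refl) (auto simp: orth)
  also have "\<dots> = (\<Sum>p\<in>S. \<integral>x. (X p x)\<^sup>2 \<partial>M)"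
    using fin by (simp add: power2_eq_square)
  finally show "(\<integral>x. (\<Sum>p\<in>S. X p x)\<^sup>2 \<partial>M) = (\<Sum>p\<in>S. \<integral>x. (X p x)\<^sup>2 \<partial>M)" .
qed

section \<open>Levels, drawn samples and the history\<close>

context mice
begin

sublocale P: prob_space P
  by (rule prob_P)

sublocale MP: pair_sigma_finite M P ..

lemma gradient_measurable:
  "(\<lambda>x. g (fst x) (snd x) $ i) \<in> borel_measurable (borel \<Otimes>\<^sub>M P)"
proof (rule borel_measurable_LIMSEQ_real)
  fix x :: "(real ^ 'd) \<times> 't" assume "x \<in> space (borel \<Otimes>\<^sub>M P)"
  then have "snd x \<in> space P"
    by (auto simp: space_pair_measure)
  then show "(\<lambda>n. (f (fst x + inverse (real (Suc n)) *\<^sub>R axis i 1) (snd x) - f (fst x) (snd x))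
      * real (Suc n)) \<longlonglongrightarrow> g (fst x) (snd x) $ i"
    by (intro gradient_component_limit f_gradient)
next
  fix n
  have shift: "(\<lambda>x. f (fst x + v) (snd x)) \<in> borel_measurable (borel \<Otimes>\<^sub>M P)" for v :: "real ^ 'd"
    using measurable_compose[OF _ f_measurable,
        of "\<lambda>x. (fst x + v, snd x)" "borel \<Otimes>\<^sub>M P"]
    by simp
  show "(\<lambda>x :: (real ^ 'd) \<times> 't. (f (fst x + inverse (real (Suc n)) *\<^sub>R axis i 1) (snd x) - f (fst x) (snd x))
      * real (Suc n)) \<in> borel_measurable (borel \<Otimes>\<^sub>M P)"
    using shift[of 0] by (intro borel_measurable_times borel_measurable_diff shift) simp_all
qed

lemma gradient_at_iterate_measurable:
  assumes "xi j \<in> borel_measurable N"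
  shows "(\<lambda>x. g (xi j (fst x)) (snd x) $ i) \<in> borel_measurable (N \<Otimes>\<^sub>M P)"
proof -
  have "(\<lambda>x. (xi j (fst x), snd x)) \<in> measurable (N \<Otimes>\<^sub>M P) (borel \<Otimes>\<^sub>M P)"
    by (intro measurable_Pair measurable_snd measurable_compose[OF measurable_fst assms])
  from measurable_compose[OF this gradient_measurable] show ?thesis by simp
qed

lemma levels_le: "l \<in> L k \<Longrightarrow> l \<le> k"
proof (induction k)
  case (Suc k)
  then show ?case
    using level_subset[of "Suc k"] by auto
qed (simp add: level_0)

lemma finite_levels: "finite (L k)"
  using finite_subset[of "L k" "{..k}"] levels_le by auto

text \<open>A level, once dropped, never returns: the only index that can enter at step \<open>n\<close> is \<open>n\<close> itself. Hence
  a current level has been present ever since its creation, and its sample sizes have grown all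
  along.\<close>

lemma level_history:
  assumes "l \<in> L k" "l \<le> j" "j \<le> k"
  shows "l \<in> L j \<and> m l j \<le> m l k"
  using assms(3)
proof (induction rule: inc_induct)
  case (step n)
  then have "l \<in> L n"
    using level_subset[of "Suc n"] assms(2) by auto
  then show ?case
    using size_mono[of "Suc n" l] step by auto
qed (use assms(1) in simp)

lemma drawn_before_iff:
  assumes "k \<ge> 1" "l \<in> L k"
  shows "(l, a) \<in> drawn_before L m k \<longleftrightarrow> l \<in> L (k - 1) \<and> a < m l (k - 1)"
proof
  assume "(l, a) \<in> drawn_before L m k"
  then obtain j where j: "j < k" "l \<in> L j" "a < m l j"
    by (auto simp: drawn_before_def)
  then have "l \<le> j" "j \<le> k - 1"
    using levels_le by auto
  then have "l \<in> L (k - 1)"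
    using level_history[of l k "k - 1"] assms j by auto
  then show "l \<in> L (k - 1) \<and> a < m l (k - 1)"
    using level_history[of l "k - 1" j] j \<open>l \<le> j\<close> by (simp add: less_le_trans)
qed (use assms in \<open>auto simp: drawn_before_def intro!: exI[of _ "k - 1"]\<close>)

text \<open>This makes every sample of level \<open>l\<close>, also one that is old at iteration \<open>k\<close>, independent of the
  iterates up to \<open>l\<close>.\<close>

lemma own_level_not_drawn: "(l, a) \<notin> drawn_before L m l"
  using levels_le by (fastforce simp: drawn_before_def)

lemma drawn_before_mono: "j \<le> k \<Longrightarrow> drawn_before L m j \<subseteq> drawn_before L m k"
  unfolding drawn_before_def by (auto intro: less_le_trans)

lemma sample_measurable: "theta p \<in> measurable M P"
  using samples_indep unfolding indep_vars_def by blast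

lemma history_measurable_into:
  assumes "xi 0 \<in> borel_measurable N"
    and "\<And>q. q \<in> drawn_before L m k \<Longrightarrow> theta q \<in> measurable N P"
  shows "history xi L m theta k \<in> measurable N (history_space P L m k)"
  unfolding history_def history_space_def
  using assms by (intro measurable_Pair measurable_restrict)

text \<open>Stated for an arbitrary sigma-algebra \<open>N\<close> that knows the starting point and the samples drawn so
  far, because it is needed for the whole space, for the history, and for the information
  carried by all samples but one.\<close>

lemma iterate_measurable_into:
  assumes "space N = space M" "xi 0 \<in> borel_measurable N"
    and "\<And>q. q \<in> drawn_before L m k \<Longrightarrow> theta q \<in> measurable N P"
    and "j \<le> k"
  shows "xi j \<in> borel_measurable N"
proof (cases j)
  case (Suc n)
  obtain G where G: "G \<in> borel_measurable (history_space P L m (Suc n))"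
      "\<And>w. w \<in> space M \<Longrightarrow> xi (Suc n) w = G (history xi L m theta (Suc n) w)"
    using iterates[of n] by blast
  have "history xi L m theta (Suc n) \<in> measurable N (history_space P L m (Suc n))"
    using assms Suc drawn_before_mono[of "Suc n" k] by (intro history_measurable_into) auto
  then have "(\<lambda>w. G (history xi L m theta (Suc n) w)) \<in> borel_measurable N"
    using G(1) by (rule measurable_compose)
  then show ?thesis
    unfolding Suc using G(2) assms(1) by (subst measurable_cong) auto
qed (use assms in simp)

lemma iterate_measurable: "xi j \<in> borel_measurable M"
  by (rule iterate_measurable_into[of M j]) (simp_all add: start_measurable sample_measurable)

lemma space_history_algebra: "space (history_algebra M P xi L m theta k) = space M"
  by (simp add: history_algebra_def)

lemma history_measurable_M: "history xi L m theta k \<in> measurable M (history_space P L m k)"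
  by (rule history_measurable_into) (simp_all add: start_measurable sample_measurable)

lemma history_measurable:
  "history xi L m theta k
     \<in> measurable (history_algebra M P xi L m theta k) (history_space P L m k)"
  unfolding history_algebra_def
  using measurable_space[OF history_measurable_M] by (intro measurable_vimage_algebra1) auto

lemma history_subalgebra: "subalgebra M (history_algebra M P xi L m theta k)"
  unfolding subalgebra_def history_algebra_def
  by (simp add: sets_image_in_sets history_measurable_M)

lemma start_measurable_history: "xi 0 \<in> borel_measurable (history_algebra M P xi L m theta k)"
  using measurable_compose[OF history_measurable, of fst k borel]
  by (simp add: history_space_def history_def)

lemma sample_measurable_history:
  assumes "q \<in> drawn_before L m k"
  shows "theta q \<in> measurable (history_algebra M P xi L m theta k) P"
proof -
  have "(\<lambda>x. snd x q) \<in> measurable (history_space P L m k) P"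
    unfolding history_space_def
    by (rule measurable_compose[OF measurable_snd measurable_component_singleton[OF assms]])
  from measurable_compose[OF history_measurable this] show ?thesis
    using assms by (simp add: history_def)
qed

lemma iterate_measurable_history:
  "j \<le> k \<Longrightarrow> xi j \<in> borel_measurable (history_algebra M P xi L m theta k)"
  by (rule iterate_measurable_into)
    (simp_all add: space_history_algebra start_measurable_history sample_measurable_history)

section \<open>Independence of one sample from all others\<close>

definition other_samples :: "nat \<times> nat \<Rightarrow> 'w measure" where
  "other_samples p = sigma (space M)
     (sets (vimage_algebra (space M) (xi 0) borel)
      \<union> sets (vimage_algebra (space M) (\<lambda>w. \<lambda>q\<in>-{p}. theta q w) (\<Pi>\<^sub>M q\<in>-{p}. P)))"

lemma
  shows space_other_samples: "space (other_samples p) = space M"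
    and sets_other_samples: "sets (other_samples p) = sigma_sets (space M)
     (sets (vimage_algebra (space M) (xi 0) borel)
      \<union> sets (vimage_algebra (space M) (\<lambda>w. \<lambda>q\<in>-{p}. theta q w) (\<Pi>\<^sub>M q\<in>-{p}. P)))"
proof -
  have "sets (vimage_algebra (space M) (xi 0) borel) \<subseteq> Pow (space M)"
      "sets (vimage_algebra (space M) (\<lambda>w. \<lambda>q\<in>-{p}. theta q w) (\<Pi>\<^sub>M q\<in>-{p}. P)) \<subseteq> Pow (space M)"
    using sets.space_closed[of "vimage_algebra (space M) (xi 0) borel"]
      sets.space_closed[of "vimage_algebra (space M) (\<lambda>w. \<lambda>q\<in>-{p}. theta q w) (\<Pi>\<^sub>M q\<in>-{p}. P)"]
    by simp_all
  then show "space (other_samples p) = space M" "sets (other_samples p) = sigma_sets (space M)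
     (sets (vimage_algebra (space M) (xi 0) borel)
      \<union> sets (vimage_algebra (space M) (\<lambda>w. \<lambda>q\<in>-{p}. theta q w) (\<Pi>\<^sub>M q\<in>-{p}. P)))"
    unfolding other_samples_def by (simp_all add: space_measure_of_conv sets_measure_of)
qed

lemma start_measurable_other_samples: "xi 0 \<in> borel_measurable (other_samples p)"
  by (rule measurableI)
    (auto simp: space_other_samples sets_other_samples intro!: sigma_sets.Basic in_vimage_algebra)

lemma sample_measurable_other_samples:
  assumes "q \<noteq> p"
  shows "theta q \<in> measurable (other_samples p) P"
proof -
  have "(\<lambda>w. \<lambda>q\<in>-{p}. theta q w) \<in> measurable (other_samples p) (\<Pi>\<^sub>M q\<in>-{p}. P)"
    by (rule measurableI)
      (auto simp: space_other_samples sets_other_samples space_PiM PiE_def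
        intro!: sigma_sets.Basic in_vimage_algebra measurable_space[OF sample_measurable])
  from measurable_compose[OF this measurable_component_singleton, of q] show ?thesis
    using assms by simp
qed

lemma iterate_measurable_other_samples:
  assumes "p \<notin> drawn_before L m k" "j \<le> k"
  shows "xi j \<in> borel_measurable (other_samples p)"
  using assms(1)
  by (intro iterate_measurable_into[OF _ _ _ assms(2)])
    (auto simp: space_other_samples start_measurable_other_samples
      intro!: sample_measurable_other_samples)

text \<open>What an undrawn sample is independent of thus includes the history on which the estimator is
  conditioned.\<close>

lemma history_algebra_le_other_samples:
  assumes "p \<notin> drawn_before L m k"
  shows "subalgebra (other_samples p) (history_algebra M P xi L m theta k)"
  unfolding subalgebra_def history_algebra_def
proof
  show "sets (vimage_algebra (space M) (history xi L m theta k) (history_space P L m k))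
      \<subseteq> sets (other_samples p)"
    using assms
    by (intro sets_image_in_sets history_measurable_into)
      (auto simp: space_other_samples start_measurable_other_samples
        intro!: sample_measurable_other_samples)
qed (simp add: space_other_samples)

text \<open>The starting point is independent of all samples jointly, and the sample \<open>p\<close> of the remaining
  ones; \<open>indep_set_join\<close> combines the two.\<close>

lemma fresh_draw: "fresh_draw M (other_samples p) P (theta p)"
proof -
  let ?A = "sets (vimage_algebra (space M) (xi 0) borel)"
  let ?B = "sets (vimage_algebra (space M) (\<lambda>w. \<lambda>q\<in>-{p}. theta q w) (\<Pi>\<^sub>M q\<in>-{p}. P))"
  let ?C = "sets (vimage_algebra (space M) (theta p) P)"
  let ?\<theta> = "\<lambda>w. \<lambda>q\<in>{p}. theta q w"
  let ?\<Theta> = "\<lambda>w. \<lambda>q\<in>UNIV. theta q w"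
  let ?D = "sets (vimage_algebra (space M) ?\<Theta> (\<Pi>\<^sub>M q\<in>UNIV. P))"
  have all: "?\<Theta> \<in> measurable (vimage_algebra (space M) ?\<Theta> (\<Pi>\<^sub>M q\<in>UNIV. P)) (\<Pi>\<^sub>M q\<in>UNIV. P)"
    by (rule measurable_vimage_algebra1)
      (auto simp: space_PiM intro!: measurable_space[OF sample_measurable])
  have each: "theta q \<in> measurable (vimage_algebra (space M) ?\<Theta> (\<Pi>\<^sub>M q\<in>UNIV. P)) P" for q
    using measurable_compose[OF all measurable_component_singleton, of q] by simp
  have sub: "?B \<subseteq> ?D" "?C \<subseteq> ?D"
    by (intro sets_image_in_sets measurable_restrict each; simp)+
  have "indep_var (\<Pi>\<^sub>M q\<in>-{p}. P) (\<lambda>w. \<lambda>q\<in>-{p}. theta q w) (\<Pi>\<^sub>M q\<in>{p}. P) ?\<theta>"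
    by (rule indep_var_restrict[OF samples_indep]) auto
  then have "indep_set ?B (sets (vimage_algebra (space M) ?\<theta> (\<Pi>\<^sub>M q\<in>{p}. P)))"
    unfolding indep_var_eq by (simp add: sets_vimage_algebra)
  moreover have "?C \<subseteq> sets (vimage_algebra (space M) ?\<theta> (\<Pi>\<^sub>M q\<in>{p}. P))"
  proof (rule sets_image_in_sets)
    have "?\<theta> \<in> measurable (vimage_algebra (space M) ?\<theta> (\<Pi>\<^sub>M q\<in>{p}. P)) (\<Pi>\<^sub>M q\<in>{p}. P)"
      by (rule measurable_vimage_algebra1)
        (auto simp: space_PiM PiE_def extensional_def intro!: measurable_space[OF sample_measurable])
    from measurable_compose[OF this measurable_component_singleton, of p]
    show "theta p \<in> measurable (vimage_algebra (space M) ?\<theta> (\<Pi>\<^sub>M q\<in>{p}. P)) P"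
      by simp
  qed simp
  ultimately have BC: "indep_set ?B ?C"
    unfolding indep_sets2_eq by blast
  have "indep_set (sigma_sets (space M) (?A \<union> ?B)) (sigma_sets (space M) ?C)"
    using sets.top[of "vimage_algebra (space M) (xi 0) borel"]
      sets.top[of "vimage_algebra (space M) (\<lambda>w. \<lambda>q\<in>-{p}. theta q w) (\<Pi>\<^sub>M q\<in>-{p}. P)"]
    by (intro indep_set_join[OF samples_indep_start BC sub] sets.Int_stable) simp_all
  moreover have "sigma_sets (space M) ?C = ?C"
    using sets.sigma_sets_eq[of "vimage_algebra (space M) (theta p) P"] by simp
  ultimately have indep: "indep_set (sets (other_samples p)) ?C"
    by (simp add: sets_other_samples)
  show ?thesis
  proof
    show "subalgebra M (other_samples p)"
      using indep_setD_ev1[OF indep] by (simp add: subalgebra_def space_other_samples)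
  qed (use indep samples_distr sample_measurable in simp_all)
qed


section \<open>Deviations of the sampled differences\<close>

lemma pred_level_less:
  assumes "Min (L k) < l" "l \<in> L k"
  shows "pred_level L k l < l"
proof -
  have "Min (L k) \<in> L k"
    using assms(2) finite_levels by (intro Min_in) auto
  then have "{l' \<in> L k. l' < l} \<noteq> {}"
    using assms(1) by auto
  then have "pred_level L k l \<in> {l' \<in> L k. l' < l}"
    unfolding pred_level_def using finite_levels by (intro Max_in) auto
  then show ?thesis by simp
qed

lemma delta_measurable:
  assumes "l \<in> L k" and xi: "\<And>j. j \<le> l \<Longrightarrow> xi j \<in> borel_measurable N"
  shows "(\<lambda>x. delta g xi L l k (fst x) (snd x) $ i) \<in> borel_measurable (N \<Otimes>\<^sub>M P)"
proof -
  have grad: "(\<lambda>x. g (xi j (fst x)) (snd x) $ i) \<in> borel_measurable (N \<Otimes>\<^sub>M P)" if "j \<le> l" for j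
    using that by (intro gradient_at_iterate_measurable xi)
  show ?thesis
    using assms(1) pred_level_less[of k l] grad[of l] grad[of "pred_level L k l"]
    by (cases "Min (L k) < l") (simp_all add: delta_def)
qed

lemma delta_integrable: "integrable P (delta g xi L l k w)"
  using g_integrable by (cases "Min (L k) < l") (simp_all add: delta_def[abs_def])

lemma delta_component_integrable: "integrable P (\<lambda>t. delta g xi L l k w t $ i)"
  by (rule integrable_bounded_linear[OF bounded_linear_vec_nth delta_integrable])

lemma delta_square_integrable:
  assumes "l \<in> L k"
  shows "integrable (M \<Otimes>\<^sub>M P) (\<lambda>x. (delta g xi L l k (fst x) (snd x) $ i)\<^sup>2)"
proof -
  have meas: "(\<lambda>x. g (xi j (fst x)) (snd x) $ i) \<in> borel_measurable (M \<Otimes>\<^sub>M P)" for j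
    by (rule gradient_at_iterate_measurable[OF iterate_measurable])
  have "integrable (M \<Otimes>\<^sub>M P) (\<lambda>x. (g (xi j (fst x)) (snd x) $ i)\<^sup>2)" for j
  proof (rule Bochner_Integration.integrable_bound)
    show "integrable (M \<Otimes>\<^sub>M P) (\<lambda>x. (norm (g (xi j (fst x)) (snd x)))\<^sup>2)"
      using square_integrable[of j] by (simp add: case_prod_unfold)
    show "AE x in M \<Otimes>\<^sub>M P. norm ((g (xi j (fst x)) (snd x) $ i)\<^sup>2)
        \<le> norm ((norm (g (xi j (fst x)) (snd x)))\<^sup>2)"
      by (rule AE_I2) (simp add: component_le_norm_cart flip: abs_le_square_iff)
  qed (use meas in simp)
  then show ?thesis
    using integrable_square_diff[OF meas meas] by (cases "Min (L k) < l") (simp_all add: delta_def)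
qed

definition mean_difference :: "nat \<Rightarrow> nat \<Rightarrow> 'd \<Rightarrow> 'w \<Rightarrow> real" where
  "mean_difference l k i w = (\<integral>t. delta g xi L l k w t $ i \<partial>P)"

lemma mean_difference_measurable:
  assumes "l \<in> L k" and "\<And>j. j \<le> l \<Longrightarrow> xi j \<in> borel_measurable N"
  shows "mean_difference l k i \<in> borel_measurable N"
proof -
  have "(\<lambda>(w, t). delta g xi L l k w t $ i) \<in> borel_measurable (N \<Otimes>\<^sub>M P)"
    using delta_measurable[OF assms, of i] by (simp add: case_prod_unfold)
  then show ?thesis
    unfolding mean_difference_def by (rule P.borel_measurable_lebesgue_integral)
qed

lemma mean_difference_measurable_M: "l \<in> L k \<Longrightarrow> mean_difference l k i \<in> borel_measurable M"
  by (rule mean_difference_measurable) (simp_all add: iterate_measurable)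

text \<open>By Jensen's inequality, in the form that a variance is nonnegative, the square of the conditional mean
  is at most the conditional second moment.\<close>

lemma mean_difference_square_integrable:
  assumes l: "l \<in> L k"
  shows "integrable M (\<lambda>w. (mean_difference l k i w)\<^sup>2)"
proof (rule Bochner_Integration.integrable_bound)
  let ?D = "\<lambda>x. (delta g xi L l k (fst x) (snd x) $ i)\<^sup>2"
  note int = delta_square_integrable[OF l, of i]
  show "integrable M (\<lambda>w. \<integral>t. ?D (w, t) \<partial>P)"
    by (rule MP.integrable_fst'[OF int])
  show "(\<lambda>w. (mean_difference l k i w)\<^sup>2) \<in> borel_measurable M"
    using mean_difference_measurable_M[OF l] by simp
  show "AE w in M. norm ((mean_difference l k i w)\<^sup>2) \<le> norm (\<integral>t. ?D (w, t) \<partial>P)"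
    using MP.AE_integrable_fst'[OF int]
  proof eventually_elim
    case (elim w)
    then have "integrable P (\<lambda>t. (delta g xi L l k w t $ i)\<^sup>2)"
      unfolding fst_conv snd_conv .
    note P.variance_eq[OF delta_component_integrable this]
    then have "(mean_difference l k i w)\<^sup>2 \<le> (\<integral>t. ?D (w, t) \<partial>P)"
      using P.variance_positive[of "\<lambda>t. delta g xi L l k w t $ i"]
      unfolding mean_difference_def fst_conv snd_conv by linarith
    moreover have "(\<integral>t. ?D (w, t) \<partial>P) \<ge> 0"
      by (rule Bochner_Integration.integral_nonneg) (rule zero_le_power2)
    ultimately show ?case
      unfolding real_norm_def by (simp only: abs_of_nonneg zero_le_power2)
  qed
qed

definition sampled_difference :: "nat \<Rightarrow> 'd \<Rightarrow> nat \<times> nat \<Rightarrow> 'w \<Rightarrow> real" where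
  "sampled_difference k i p w = delta g xi L (fst p) k w (theta p w) $ i"

definition deviation :: "nat \<Rightarrow> 'd \<Rightarrow> nat \<times> nat \<Rightarrow> 'w \<Rightarrow> real" where
  "deviation k i p w = sampled_difference k i p w - mean_difference (fst p) k i w"

lemma sampled_difference_measurable:
  assumes "fst p \<in> L k" "space N = space M" "theta p \<in> measurable N P"
    and "\<And>j. j \<le> fst p \<Longrightarrow> xi j \<in> borel_measurable N"
  shows "sampled_difference k i p \<in> borel_measurable N"
proof -
  have "(\<lambda>w. (w, theta p w)) \<in> measurable N (N \<Otimes>\<^sub>M P)"
    using assms(3) by simp
  from measurable_compose[OF this delta_measurable[OF assms(1), of N i]] assms(4) show ?thesis
    by (simp add: sampled_difference_def[abs_def])
qed

lemma sampled_difference_measurable_M: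
  "fst p \<in> L k \<Longrightarrow> sampled_difference k i p \<in> borel_measurable M"
  by (rule sampled_difference_measurable) (simp_all add: sample_measurable iterate_measurable)

text \<open>The samples drawn before iteration \<open>k\<close> are covered through an earlier history: the difference of
  level \<open>fst p\<close> depends on iterates up to \<open>fst p\<close> only, and \<open>p\<close> is fresh at that iteration.\<close>

lemma sampled_difference_square_integrable:
  assumes "fst p \<in> L k"
  shows "integrable M (\<lambda>w. (sampled_difference k i p w)\<^sup>2)"
proof -
  interpret fresh_draw M "other_samples p" P "theta p"
    by (rule fresh_draw)
  have "p \<notin> drawn_before L m (fst p)"
    using own_level_not_drawn[of "fst p" "snd p"] by simp
  then have "(\<lambda>x. (delta g xi L (fst p) k (fst x) (snd x) $ i)\<^sup>2)
      \<in> borel_measurable (other_samples p \<Otimes>\<^sub>M P)"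
    by (intro borel_measurable_power delta_measurable[OF assms] iterate_measurable_other_samples)
  from integrable_draw_iff[OF this] delta_square_integrable[OF assms, of i] show ?thesis
    unfolding sampled_difference_def fst_conv snd_conv by blast
qed

lemma deviation_measurable_M: "fst p \<in> L k \<Longrightarrow> deviation k i p \<in> borel_measurable M"
  unfolding deviation_def[abs_def]
  by (intro borel_measurable_diff sampled_difference_measurable_M mean_difference_measurable_M)

lemma deviation_square_integrable:
  assumes "fst p \<in> L k"
  shows "integrable M (\<lambda>w. (deviation k i p w)\<^sup>2)"
  unfolding deviation_def
  by (intro integrable_square_diff sampled_difference_measurable_M mean_difference_measurable_M
      sampled_difference_square_integrable mean_difference_square_integrable assms)

lemma centred_difference_measurable:
  assumes "l \<in> L k" "p \<notin> drawn_before L m k"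
  shows "(\<lambda>x. delta g xi L l k (fst x) (snd x) $ i - mean_difference l k i (fst x))
      \<in> borel_measurable (other_samples p \<Otimes>\<^sub>M P)"
proof -
  have xi: "xi j \<in> borel_measurable (other_samples p)" if "j \<le> l" for j
    using that levels_le[OF assms(1)] by (intro iterate_measurable_other_samples[OF assms(2)]) simp
  show ?thesis
    by (intro borel_measurable_diff delta_measurable assms xi
        measurable_compose[OF measurable_fst mean_difference_measurable])
qed

lemma deviation_orthogonal:
  assumes p: "fst p \<in> L k" "p \<notin> drawn_before L m k"
    and \<psi>: "\<psi> \<in> borel_measurable (other_samples p)"
  shows "(\<integral>w. \<psi> w * deviation k i p w \<partial>M) = 0"
proof -
  interpret fresh_draw M "other_samples p" P "theta p"
    by (rule fresh_draw)
  let ?\<phi> = "\<lambda>x. delta g xi L (fst p) k (fst x) (snd x) $ i - mean_difference (fst p) k i (fst x)"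
  have "(\<integral>t. ?\<phi> (w, t) \<partial>P) = 0" for w
    using delta_component_integrable by (simp add: mean_difference_def P.prob_space)
  then show ?thesis
    using centred_draw_orthogonal[OF centred_difference_measurable[OF p] \<psi>]
    by (simp add: deviation_def sampled_difference_def)
qed

text \<open>Since \<open>p\<close> is undrawn, the iterates up to \<open>k\<close> are functions of the starting point and the samples other
  than \<open>p\<close>; so the deviation at any \<open>q \<noteq> p\<close> is one as well, whether \<open>q\<close> is fresh or old.\<close>

lemma deviations_orthogonal:
  assumes p: "fst p \<in> L k" "p \<notin> drawn_before L m k"
    and q: "fst q \<in> L k" "q \<noteq> p"
  shows "(\<integral>w. deviation k i q w * deviation k i p w \<partial>M) = 0"
proof (rule deviation_orthogonal[OF p])
  have xi: "xi j \<in> borel_measurable (other_samples p)" if "j \<le> fst q" for j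
    using that levels_le[OF q(1)] by (intro iterate_measurable_other_samples[OF p(2)]) simp
  show "deviation k i q \<in> borel_measurable (other_samples p)"
    unfolding deviation_def[abs_def]
    by (intro borel_measurable_diff sampled_difference_measurable mean_difference_measurable
        xi q space_other_samples sample_measurable_other_samples)
qed

lemma deviation_second_moment:
  assumes p: "fst p \<in> L k" "p \<notin> drawn_before L m k"
  shows "integrable M (\<lambda>w. P.variance (\<lambda>t. delta g xi L (fst p) k w t $ i))"
    and "(\<integral>w. (deviation k i p w)\<^sup>2 \<partial>M)
       = (\<integral>w. P.variance (\<lambda>t. delta g xi L (fst p) k w t $ i) \<partial>M)"
proof -
  interpret fresh_draw M "other_samples p" P "theta p"
    by (rule fresh_draw)
  let ?\<phi> = "\<lambda>x. delta g xi L (fst p) k (fst x) (snd x) $ i - mean_difference (fst p) k i (fst x)"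
  have \<phi>: "(\<lambda>x. (?\<phi> x)\<^sup>2) \<in> borel_measurable (other_samples p \<Otimes>\<^sub>M P)"
    by (intro borel_measurable_power centred_difference_measurable[OF p])
  have dev: "(deviation k i p w)\<^sup>2 = (?\<phi> (w, theta p w))\<^sup>2" for w
    by (simp add: deviation_def sampled_difference_def)
  have var: "P.variance (\<lambda>t. delta g xi L (fst p) k w t $ i) = (\<integral>t. (?\<phi> (w, t))\<^sup>2 \<partial>P)" for w
    by (simp add: mean_difference_def)
  have int: "integrable (M \<Otimes>\<^sub>M P) (\<lambda>x. (?\<phi> x)\<^sup>2)"
    using deviation_square_integrable[OF p(1), of i] integrable_draw_iff[OF \<phi>] unfolding dev by blast
  show "integrable M (\<lambda>w. P.variance (\<lambda>t. delta g xi L (fst p) k w t $ i))"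
    unfolding var by (rule MP.integrable_fst'[OF int])
  show "(\<integral>w. (deviation k i p w)\<^sup>2 \<partial>M)
      = (\<integral>w. P.variance (\<lambda>t. delta g xi L (fst p) k w t $ i) \<partial>M)"
    unfolding var dev integral_draw[OF \<phi>] by (rule MP.integral_fst'[OF int, symmetric])
qed

section \<open>The statistical error\<close>

definition samples_used :: "nat \<Rightarrow> (nat \<times> nat) set" where
  "samples_used k = (SIGMA l:L k. {..<m l k})"

definition samples_fresh :: "nat \<Rightarrow> (nat \<times> nat) set" where
  "samples_fresh k = samples_used k - drawn_before L m k"

lemma finite_samples_used: "finite (samples_used k)"
  unfolding samples_used_def using finite_levels by simp

lemma finite_samples_fresh: "finite (samples_fresh k)"
  unfolding samples_fresh_def using finite_samples_used by simp

lemma samples_fresh_eq: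
  assumes "k \<ge> 1"
  shows "samples_fresh k
    = (SIGMA l:L k. if l \<in> L (k - 1) then {m l (k - 1)..<m l k} else {..<m l k})"
  unfolding samples_fresh_def samples_used_def
  using drawn_before_iff[OF assms] by (auto split: if_splits)

lemma estimator_component:
  "mice_estimator g xi L m theta k w $ i
     = (\<Sum>p\<in>samples_used k. sampled_difference k i p w / real (m (fst p) k))"
  unfolding mice_estimator_def mu_hat_def samples_used_def sampled_difference_def
  using finite_levels by (simp add: sum.Sigma case_prod_unfold sum_component sum_divide_distrib)

text \<open>Replacing each fresh difference by its mean leaves a quantity that is known from the history; what has
  been taken away integrates to \<open>0\<close> over every event of the history. This characterises the conditional
  expectation.\<close>

lemma estimator_deviation:
  "AE w in M. mice_estimator g xi L m theta k w $ i
      - vec_cond_exp M (history_algebra M P xi L m theta k) (mice_estimator g xi L m theta k) w $ i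
    = (\<Sum>p\<in>samples_fresh k. deviation k i p w / real (m (fst p) k))"
proof -
  let ?H = "history_algebra M P xi L m theta k"
  let ?c = "\<lambda>p. real (m (fst p) k)"
  let ?Y = "\<lambda>w. mice_estimator g xi L m theta k w $ i"
  let ?R = "\<lambda>w. \<Sum>p\<in>samples_fresh k. deviation k i p w / ?c p"
  define G where "G w = (\<Sum>p\<in>samples_used k \<inter> drawn_before L m k. sampled_difference k i p w / ?c p)
      + (\<Sum>p\<in>samples_fresh k. mean_difference (fst p) k i w / ?c p)" for w
  have used: "fst p \<in> L k" if "p \<in> samples_used k" for p
    using that by (auto simp: samples_used_def)
  have fresh: "fst p \<in> L k" "p \<notin> drawn_before L m k" if "p \<in> samples_fresh k" for p
    using that used by (auto simp: samples_fresh_def)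
  have split: "?Y w = G w + ?R w" for w
  proof -
    have "?Y w = (\<Sum>p\<in>samples_used k \<inter> drawn_before L m k. sampled_difference k i p w / ?c p)
        + (\<Sum>p\<in>samples_fresh k. sampled_difference k i p w / ?c p)"
      unfolding estimator_component samples_fresh_def
      by (rule sum.Int_Diff[OF finite_samples_used])
    then show ?thesis
      by (simp add: G_def deviation_def diff_divide_distrib sum_subtractf)
  qed
  note sub = history_subalgebra[of k]
  interpret H: finite_measure_subalgebra M ?H
    by unfold_locales (rule sub)
  have xi: "xi j \<in> borel_measurable ?H" if "j \<le> l" "l \<in> L k" for j l
    using that levels_le by (intro iterate_measurable_history) (auto dest: levels_le)
  have int_Y: "integrable M ?Y"
    unfolding estimator_component
    by (intro Bochner_Integration.integrable_sum integrable_divide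
        square_integrable_imp_integrable[OF sampled_difference_measurable_M
          sampled_difference_square_integrable] used)
  have int_dev: "integrable M (deviation k i p)" if "p \<in> samples_fresh k" for p
    by (intro square_integrable_imp_integrable[OF deviation_measurable_M
          deviation_square_integrable] fresh that)
  have int_R: "integrable M ?R"
    using int_dev by simp
  have int_G: "integrable M G"
    using Bochner_Integration.integrable_diff[OF int_Y int_R] unfolding split by simp
  have meas_G: "G \<in> borel_measurable ?H"
    unfolding G_def[abs_def]
    by (intro borel_measurable_add borel_measurable_sum borel_measurable_divide
        borel_measurable_const sampled_difference_measurable mean_difference_measurable
        space_history_algebra sample_measurable_history xi used fresh)
      (auto intro: xi used fresh)
  have "AE w in M. real_cond_exp M ?H ?Y w = G w"
  proof (rule H.real_cond_exp_charact)
    fix A assume A: "A \<in> sets ?H"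
    then have AM: "A \<in> sets M"
      using sub by (auto simp: subalgebra_def)
    have zero: "(\<integral>w. indicator A w * deviation k i p w \<partial>M) = 0" if p: "p \<in> samples_fresh k" for p
    proof (rule deviation_orthogonal[OF fresh[OF p]])
      have "A \<in> sets (other_samples p)"
        using A history_algebra_le_other_samples[OF fresh(2)[OF p]] by (auto simp: subalgebra_def)
      then show "indicator A \<in> borel_measurable (other_samples p)"
        by (rule borel_measurable_indicator)
    qed
    have int_A: "integrable M (\<lambda>w. indicator A w * h w)" if "integrable M h" for h :: "'w \<Rightarrow> real"
      using integrable_mult_indicator[OF AM that] by simp
    have "(\<integral>w. indicator A w * ?R w \<partial>M)
        = (\<Sum>p\<in>samples_fresh k. (\<integral>w. indicator A w * deviation k i p w \<partial>M) / ?c p)"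
      using int_A int_dev by (simp add: sum_distrib_left)
    also have "\<dots> = 0"
      using zero by simp
    finally show "(\<integral>w\<in>A. ?Y w \<partial>M) = (\<integral>w\<in>A. G w \<partial>M)"
      using int_A[OF int_G] int_A[OF int_R]
      by (simp add: set_lebesgue_integral_def split distrib_left)
  qed (fact int_Y int_G meas_G)+
  then show ?thesis
    by eventually_elim (simp add: vec_cond_exp_def split)
qed

lemma level_variance_integrable:
  assumes "k \<ge> 1" "l \<in> L k"
  shows "integrable M (level_variance P g xi L l k)"
proof -
  \<comment> \<open>Any undrawn sample of level \<open>l\<close> serves to read off the moment, even one outside the estimator.\<close>
  have "(l, m l (k - 1)) \<notin> drawn_before L m k"
    using drawn_before_iff[OF assms] by simp
  then show ?thesis
    unfolding level_variance_def[abs_def]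
    using deviation_second_moment(1)[of "(l, m l (k - 1))" k] assms(2)
    by (intro Bochner_Integration.integrable_sum) simp
qed

lemma deviation_total_second_moment:
  assumes p: "fst p \<in> L k" "p \<notin> drawn_before L m k"
  shows "(\<Sum>i\<in>UNIV. \<integral>w. (deviation k i p w)\<^sup>2 \<partial>M)
       = (\<integral>w. level_variance P g xi L (fst p) k w \<partial>M)"
  unfolding level_variance_def deviation_second_moment(2)[OF p]
  by (rule Bochner_Integration.integral_sum[symmetric]) (rule deviation_second_moment(1)[OF p])

lemma statistical_error_eq_sum_fresh:
  "(\<integral>w. (norm (mice_estimator g xi L m theta k w
        - vec_cond_exp M (history_algebra M P xi L m theta k)
            (mice_estimator g xi L m theta k) w))\<^sup>2 \<partial>M)
   = (\<Sum>p\<in>samples_fresh k.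
        (\<integral>w. level_variance P g xi L (fst p) k w \<partial>M) / (real (m (fst p) k))\<^sup>2)"
  (is "?error = _")
proof -
  let ?H = "history_algebra M P xi L m theta k"
  let ?c = "\<lambda>p. real (m (fst p) k)"
  let ?Y = "mice_estimator g xi L m theta k"
  let ?R = "\<lambda>i w. \<Sum>p\<in>samples_fresh k. deviation k i p w / ?c p"
  have fresh: "fst p \<in> L k" "p \<notin> drawn_before L m k" if "p \<in> samples_fresh k" for p
    using that by (auto simp: samples_fresh_def samples_used_def)
  have scaled_meas: "(\<lambda>w. deviation k i p w / ?c p) \<in> borel_measurable M"
    and scaled_int: "integrable M (\<lambda>w. (deviation k i p w / ?c p)\<^sup>2)"
    if "p \<in> samples_fresh k" for i p
    using deviation_measurable_M[OF fresh(1)[OF that]]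
      deviation_square_integrable[OF fresh(1)[OF that], of i]
    by (simp_all add: power_divide)
  have scaled_orth: "(\<integral>w. (deviation k i q w / ?c q) * (deviation k i p w / ?c p) \<partial>M) = 0"
    if "q \<in> samples_fresh k" "p \<in> samples_fresh k" "q \<noteq> p" for i p q
    using deviations_orthogonal[OF fresh[OF that(2)] fresh(1)[OF that(1)] that(3)] by simp
  have square_sum: "integrable M (\<lambda>w. (?R i w)\<^sup>2)"
      "(\<integral>w. (?R i w)\<^sup>2 \<partial>M) = (\<Sum>p\<in>samples_fresh k. \<integral>w. (deviation k i p w / ?c p)\<^sup>2 \<partial>M)" for i
    by (intro integral_square_sum_orthogonal finite_samples_fresh scaled_meas scaled_int scaled_orth;
        assumption)+
  have used: "fst p \<in> L k" if "p \<in> samples_used k" for p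
    using that by (auto simp: samples_used_def)
  have meas_Y: "(\<lambda>w. ?Y w $ i) \<in> borel_measurable M" for i
    unfolding estimator_component
    by (intro borel_measurable_sum borel_measurable_divide borel_measurable_const
        sampled_difference_measurable_M used)
  have norm_square: "(norm v)\<^sup>2 = (\<Sum>i\<in>UNIV. (v $ i)\<^sup>2)" for v :: "real ^ 'd"
    unfolding power2_norm_eq_inner inner_vec_def by (simp add: power2_eq_square)
  have "?error = (\<integral>w. (\<Sum>i\<in>UNIV. (?Y w $ i - vec_cond_exp M ?H ?Y w $ i)\<^sup>2) \<partial>M)"
    unfolding norm_square vector_minus_component ..
  also have "\<dots> = (\<integral>w. (\<Sum>i\<in>UNIV. (?R i w)\<^sup>2) \<partial>M)"
  proof (rule integral_cong_AE)
    show "(\<lambda>w. \<Sum>i\<in>UNIV. (?Y w $ i - vec_cond_exp M ?H ?Y w $ i)\<^sup>2) \<in> borel_measurable M"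
      unfolding vec_cond_exp_def vec_lambda_beta
      by (intro borel_measurable_sum borel_measurable_power borel_measurable_diff meas_Y
          borel_measurable_cond_exp2)
    show "(\<lambda>w. \<Sum>i\<in>UNIV. (?R i w)\<^sup>2) \<in> borel_measurable M"
      by (intro borel_measurable_sum borel_measurable_power scaled_meas)
    have "AE w in M. \<forall>i\<in>UNIV. ?Y w $ i - vec_cond_exp M ?H ?Y w $ i = ?R i w"
      by (intro AE_finite_allI estimator_deviation) simp
    then show "AE w in M. (\<Sum>i\<in>UNIV. (?Y w $ i - vec_cond_exp M ?H ?Y w $ i)\<^sup>2)
        = (\<Sum>i\<in>UNIV. (?R i w)\<^sup>2)"
      by eventually_elim simp
  qed
  also have "\<dots> = (\<Sum>i\<in>UNIV. \<integral>w. (?R i w)\<^sup>2 \<partial>M)"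
    by (rule Bochner_Integration.integral_sum) (rule square_sum(1))
  also have "\<dots> = (\<Sum>i\<in>UNIV. \<Sum>p\<in>samples_fresh k. (\<integral>w. (deviation k i p w)\<^sup>2 \<partial>M) / (?c p)\<^sup>2)"
    unfolding square_sum(2) by (simp add: power_divide)
  also have "\<dots> = (\<Sum>p\<in>samples_fresh k. (\<Sum>i\<in>UNIV. \<integral>w. (deviation k i p w)\<^sup>2 \<partial>M) / (?c p)\<^sup>2)"
    unfolding sum_divide_distrib by (rule sum.swap)
  also have "\<dots> = (\<Sum>p\<in>samples_fresh k.
        (\<integral>w. level_variance P g xi L (fst p) k w \<partial>M) / (?c p)\<^sup>2)"
    by (intro sum.cong refl arg_cong2[where f="(/)"] deviation_total_second_moment fresh)
  finally show ?thesis .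
qed

end

theorem proposition4:
  fixes M :: "'w measure"
    and P :: "'t measure"
    and f :: "real ^ 'd \<Rightarrow> 't \<Rightarrow> real"
    and g :: "real ^ 'd \<Rightarrow> 't \<Rightarrow> real ^ 'd"
    and xi :: "nat \<Rightarrow> 'w \<Rightarrow> real ^ 'd"
    and L :: "nat \<Rightarrow> nat set"
    and m :: "nat \<Rightarrow> nat \<Rightarrow> nat"
    and theta :: "nat \<times> nat \<Rightarrow> 'w \<Rightarrow> 't"
    and k :: nat
  assumes "mice M P f g xi L m theta"
    and "k \<ge> 1"
    and "\<And>l w t. l \<in> L k \<inter> L (k - 1) \<Longrightarrow> w \<in> space M \<Longrightarrow> t \<in> space P
           \<Longrightarrow> delta g xi L l k w t = delta g xi L l (k - 1) w t"
  shows "(\<integral>w. (norm (mice_estimator g xi L m theta k w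
              - vec_cond_exp M (history_algebra M P xi L m theta k)
                  (mice_estimator g xi L m theta k) w))\<^sup>2 \<partial>M)
       = (\<integral>w. (\<Sum>l\<in>L k \<inter> L (k - 1).
              (real (m l k) - real (m l (k - 1))) * level_variance P g xi L l k w
                / (real (m l k))\<^sup>2) \<partial>M)
         + (\<integral>w. level_variance P g xi L k k w / real (m k k) \<partial>M)"
proof -
  interpret mice M P f g xi L m theta by fact
  let ?E = "\<lambda>l. \<integral>w. level_variance P g xi L l k w \<partial>M"
  let ?n = "\<lambda>l. card (if l \<in> L (k - 1) then {m l (k - 1)..<m l k} else {..<m l k})"
  have new_level: "k \<notin> L (k - 1)"
    using levels_le[of k "k - 1"] \<open>k \<ge> 1\<close> by auto
  have levels: "L k = insert k (L k \<inter> L (k - 1))"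
    using level_subset[of k] level_mem[of k] \<open>k \<ge> 1\<close> by auto
  have "(\<integral>w. (norm (mice_estimator g xi L m theta k w
              - vec_cond_exp M (history_algebra M P xi L m theta k)
                  (mice_estimator g xi L m theta k) w))\<^sup>2 \<partial>M)
      = (\<Sum>l\<in>L k. real (?n l) * (?E l / (real (m l k))\<^sup>2))"
    unfolding statistical_error_eq_sum_fresh samples_fresh_eq[OF \<open>k \<ge> 1\<close>]
    by (subst sum.Sigma[symmetric, of _ _ "\<lambda>l a. ?E l / (real (m l k))\<^sup>2", unfolded case_prod_unfold])
      (simp_all add: finite_levels)
  also have "\<dots> = (\<Sum>l\<in>L k \<inter> L (k - 1). real (?n l) * (?E l / (real (m l k))\<^sup>2))
      + real (?n k) * (?E k / (real (m k k))\<^sup>2)"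
    using new_level finite_levels[of k] by (subst levels) simp
  also have "real (?n k) * (?E k / (real (m k k))\<^sup>2)
      = (\<integral>w. level_variance P g xi L k k w / real (m k k) \<partial>M)"
    using new_level by (simp add: power2_eq_square)
  also have "(\<Sum>l\<in>L k \<inter> L (k - 1). real (?n l) * (?E l / (real (m l k))\<^sup>2))
      = (\<Sum>l\<in>L k \<inter> L (k - 1). \<integral>w. (real (m l k) - real (m l (k - 1)))
          * level_variance P g xi L l k w / (real (m l k))\<^sup>2 \<partial>M)"
    using size_mono[OF \<open>k \<ge> 1\<close>] by (intro sum.cong refl) (simp add: of_nat_diff)
  also have "\<dots> = (\<integral>w. (\<Sum>l\<in>L k \<inter> L (k - 1). (real (m l k) - real (m l (k - 1)))
          * level_variance P g xi L l k w / (real (m l k))\<^sup>2) \<partial>M)"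
    using level_variance_integrable[OF \<open>k \<ge> 1\<close>]
    by (intro Bochner_Integration.integral_sum[symmetric]) simp
  finally show ?thesis .
qed

end
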